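(* For every integer $n\ge 3$ we have \begin{align*} A_1(2n,3)&=\frac{7}8\,\zeta(2n)+\zeta(\overline{2n}),\\ A_2(2n,3)&=\frac{7}8\,\zeta(2n)+\zeta(\overline{2n}). \end{align*}
   Context: For positive integers $s_1,\dots,s_d$ and signs $\varepsilon_1,\dots,\varepsilon_d\in\{1,-1\}$ with $(s_1,\varepsilon_1)\ne(1,1)$, the (alternating) Euler sum is $$\zeta(s_1,\dots,s_d;\varepsilon_1,\dots,\varepsilon_d)=\sum_{n_1>\cdots>n_d\ge 1}\frac{\varepsilon_1^{n_1}\cdots \varepsilon_d^{n_d}}{ n_1^{s_1}\cdots n_d^{s_d}}.$$ For integers $0\le\alpha\le d\le n$, $$A_\alpha(2n,d)=\sum \zeta(2j_1,\dots,2j_d;\varepsilon_1,\dots,\varepsilon_d),$$ where the sum is over all positive integers $j_1,\dots,j_d$ with $j_1+\cdots+j_d=n$ and all $(\varepsilon_1,\dots,\varepsilon_d)\in\{1,-1\}^d$ with exactly $\alpha$ of the $\varepsilon_\ell$ equal to $-1$. Also $\zeta(m)$ is the Riemann zeta value and $\zeta(\overline{m})=\sum_{k\ge1}(-1)^k k^{-m}=(2^{1-m}-1)\zeta(m)$ for $m\ge 2$. *)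

theory Defs
  imports "HOL-Analysis.Analysis"
begin

text \<open>
  The tuples \<open>N \<ge> n\<^sub>1 > \<dots> > n\<^sub>d \<ge> 1\<close>, as lists of length \<open>d\<close>; the paper's index \<open>\<ell>\<close> is
  list position \<open>\<ell> - 1\<close>, here and for the exponents and signs below.
\<close>

definition decr_tuples :: "nat \<Rightarrow> nat \<Rightarrow> nat list set" where
  "decr_tuples d N = {ns. length ns = d \<and> sorted_wrt (>) ns \<and> set ns \<subseteq> {1..N}}"

text \<open>
  \<open>\<zeta>(s\<^sub>1,\<dots>,s\<^sub>d; \<epsilon>\<^sub>1,\<dots>,\<epsilon>\<^sub>d)\<close>. The series is taken as the limit of its partial sums over
  \<open>n\<^sub>1 \<le> N\<close>, because it need not converge absolutely when \<open>(s\<^sub>1,\<epsilon>\<^sub>1) = (1,-1)\<close>. The value is only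
  meaningful for \<open>length es = length ss\<close>, positive exponents, signs in \<open>{1,-1}\<close> and
  \<open>(s\<^sub>1,\<epsilon>\<^sub>1) \<noteq> (1,1)\<close>.
\<close>

definition euler_sum :: "nat list \<Rightarrow> real list \<Rightarrow> real" where
  "euler_sum ss es =
     lim (\<lambda>N. \<Sum>ns\<in>decr_tuples (length ss) N.
           \<Prod>i<length ss. (es ! i) ^ (ns ! i) / real (ns ! i) ^ (ss ! i))"

text \<open>
  \<open>A\<^sub>\<alpha>(w,d)\<close>; the first argument after \<open>\<alpha>\<close> is the weight \<open>w = 2n\<close>, as in the paper's notation, so
  the condition \<open>j\<^sub>1 + \<dots> + j\<^sub>d = n\<close> reads \<open>2 * sum_list js = w\<close>. All exponents \<open>2j\<^sub>\<ell>\<close> are at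
  least 2, so every summand converges.
\<close>

definition A_index :: "nat \<Rightarrow> nat \<Rightarrow> nat \<Rightarrow> (nat list \<times> real list) set" where
  "A_index \<alpha> w d =
     {(js, es). length js = d \<and> (\<forall>j\<in>set js. 1 \<le> j) \<and> 2 * sum_list js = w \<and>
                length es = d \<and> set es \<subseteq> {1, -1} \<and> count_list es (-1) = \<alpha>}"

definition A :: "nat \<Rightarrow> nat \<Rightarrow> nat \<Rightarrow> real" where
  "A \<alpha> w d = (\<Sum>(js, es)\<in>A_index \<alpha> w d. euler_sum (map (\<lambda>j. 2 * j) js) es)"

definition zeta :: "nat \<Rightarrow> real" where
  "zeta m = (\<Sum>k. 1 / real (Suc k) ^ m)"

definition zeta_bar :: "nat \<Rightarrow> real" where
  "zeta_bar m = (\<Sum>k. (-1) ^ Suc k / real (Suc k) ^ m)"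

end

theory Submission
  imports Defs
begin

text \<open>
Fix the weight through a generating function in an indeterminate \<open>t\<close>. Summing
\<open>1 / (a\<^sup>2\<^sup>i b\<^sup>2\<^sup>j c\<^sup>2\<^sup>k)\<close> over all positive \<open>i\<close>, \<open>j\<close>, \<open>k\<close> with sum \<open>n\<close> picks the coefficient of \<open>t\<close> to the
power \<open>n\<close> in a product of geometric series \<open>x\<^sub>m = t / (m\<^sup>2 - t)\<close>, and summing over the sign patterns turns
the signs into factors \<open>(-1)\<close> to the power \<open>m\<close>. So \<open>A\<^sub>1\<close> and \<open>A\<^sub>2\<close> are the coefficients of the sums over
\<open>a > b > c\<close> of \<open>x\<^sub>a x\<^sub>b x\<^sub>c\<close>, weighted by the elementary symmetric functions of degree 1 and 2 in the three
signs.

Such sums over decreasing triples are polynomials in power sums (lemma \<open>sum_triangle_triple\<close>), and as the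
sign only depends on parity, only the power sums \<open>p\<^sub>k\<close> of the \<open>x\<^sub>m\<close> with \<open>m\<close> even and \<open>q\<^sub>k\<close> of those with
\<open>m\<close> odd occur. Write \<open>P = p\<^sub>1\<close> and \<open>Q = q\<^sub>1\<close>; their coefficients are rational multiples of even zeta values.

With the derivation \<open>D = t d/dt\<close> one has \<open>D x\<^sub>m = x\<^sub>m + x\<^sub>m\<^sup>2\<close>, so \<open>p\<^sub>2\<close> and \<open>p\<^sub>3\<close> are given by
\<open>P\<close> and its derivatives. What makes everything collapse are three quadratic relations
(lemma \<open>ap_series_product\<close>), where \<open>T\<close> is the linear term of \<open>P\<close>:
\<open>P\<^sup>2 = p\<^sub>2 + 3/2 (P - T)\<close>, \<open>Q\<^sup>2 = q\<^sub>2 + 1/2 (Q - 3T)\<close> and \<open>P Q = 1/2 (Q - 3T)\<close>. They are the power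
series form of the differential equations for \<open>a cot a\<close> and \<open>a tan a\<close> and of \<open>cot a tan a = 1\<close>, where
\<open>2a = \<pi> \<surd>t\<close>, since
\<open>1 - 2P = a cot a\<close> and \<open>2Q = a tan a\<close>. Their proof here is by partial fractions:
\<open>x\<^sub>m x\<^sub>k = t (x\<^sub>m - x\<^sub>k) / (k\<^sup>2 - m\<^sup>2)\<close> for \<open>m \<noteq> k\<close>, and the sum of \<open>1 / (k\<^sup>2 - m\<^sup>2)\<close> over all
\<open>k\<close> of one parity telescopes to a rational multiple of \<open>1 / m\<^sup>2\<close>.

Modulo these relations both polynomials become \<open>15/8 P - 1/8 Q - 3/2 T\<close> (lemma \<open>power_sum_relations\<close>, with
denominators cleared). The linear term \<open>T\<close> is invisible in degree \<open>n\<close>, and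
\<open>15/8 P - 1/8 Q = 7/8 (P + Q) + (P - Q)\<close>, where \<open>P + Q\<close> and \<open>P - Q\<close> generate
\<open>\<zeta>(2n)\<close> and its alternating counterpart.
\<close>

unbundle no vec_syntax and fps_syntax

section \<open>Geometric series and their partial fractions\<close>

text \<open>
The expansion of \<open>t / (m\<^sup>2 - t)\<close>. It has no constant term because all exponents in the Euler sums are
positive.
\<close>

definition geo :: "nat \<Rightarrow> real fps" where
  "geo m = Abs_fps (\<lambda>j. if j = 0 then 0 else 1 / real m ^ (2 * j))"

lemma geo_nth: "geo m $ j = (if j = 0 then 0 else 1 / real m ^ (2 * j))"
  by (simp add: geo_def)

lemma geo_times_denominator:
  assumes "m > 0"
  shows "geo m * (fps_const (real m ^ 2) - fps_X) = fps_X"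
proof (rule fps_ext)
  fix j
  show "(geo m * (fps_const (real m ^ 2) - fps_X)) $ j = fps_X $ j"
  proof (cases j)
    case (Suc l)
    have "geo m $ j * real m ^ 2 - geo m $ l = fps_X $ j"
      using assms Suc by (auto simp: geo_nth power2_eq_square)
    then show ?thesis using Suc by (simp add: right_diff_distrib)
  qed (simp add: right_diff_distrib geo_nth)
qed

lemma geo_denominator_nonzero:
  assumes "m > 0" shows "fps_const (real m ^ 2) - fps_X \<noteq> (0 :: real fps)"
proof
  assume "fps_const (real m ^ 2) - fps_X = (0 :: real fps)"
  then have "(fps_const (real m ^ 2) - fps_X) $ 0 = (0 :: real)" by simp
  with assms show False by simp
qed

text \<open>
The partial fraction decomposition of \<open>t / (m\<^sup>2 - t) \<cdot> t / (k\<^sup>2 - t)\<close>. It replaces the product of two series by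
a difference, which is why a double sum over \<open>m\<close> and \<open>k\<close> reduces to single sums.
\<close>

lemma geo_mult:
  assumes "m > 0" "k > 0" "m \<noteq> k"
  shows "geo m * geo k = fps_const (1 / (real k ^ 2 - real m ^ 2)) * (fps_X * (geo m - geo k))"
proof -
  let ?u = "fps_const (real m ^ 2) - fps_X :: real fps" and ?v = "fps_const (real k ^ 2) - fps_X :: real fps"
  let ?d = "fps_const (real k ^ 2 - real m ^ 2) :: real fps"
  have d: "real k ^ 2 - real m ^ 2 \<noteq> 0"
    using assms by (metis eq_iff_diff_eq_0 of_nat_eq_iff of_nat_0_le_iff power2_eq_imp_eq)
  have dv: "?d = ?v - ?u" by simp
  have "(?d * (geo m * geo k)) * (?u * ?v) = ?d * ((geo m * ?u) * (geo k * ?v))"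
    by (simp only: ac_simps)
  also have "\<dots> = (?v - ?u) * (fps_X * fps_X)"
    using assms by (simp only: geo_times_denominator dv)
  also have "\<dots> = (fps_X * ((geo m * ?u) * ?v - (geo k * ?v) * ?u))"
    using assms by (simp only: geo_times_denominator) (simp only: algebra_simps)
  also have "\<dots> = (fps_X * (geo m - geo k)) * (?u * ?v)"
    by (simp only: algebra_simps)
  finally have "?d * (geo m * geo k) = fps_X * (geo m - geo k)"
    using geo_denominator_nonzero[of m] geo_denominator_nonzero[of k] assms by simp
  then have "fps_const (1 / (real k ^ 2 - real m ^ 2)) * (?d * (geo m * geo k))
     = fps_const (1 / (real k ^ 2 - real m ^ 2)) * (fps_X * (geo m - geo k))" by simp
  moreover have "fps_const (1 / (real k ^ 2 - real m ^ 2)) * ?d = 1"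
    using d by (simp only: fps_const_mult) simp
  ultimately show ?thesis by (simp only: mult.assoc[symmetric] mult_1)
qed

text \<open>
Follows by differentiating \<open>geo m (m\<^sup>2 - t) = t\<close>. This is what expresses sums of squares and cubes of
\<open>geo m\<close> by derivatives of the plain sum.
\<close>

lemma fps_XD_geo:
  assumes "m > 0"
  shows "fps_XD (geo m) = geo m + geo m ^ 2"
proof -
  let ?u = "fps_const (real m ^ 2) - fps_X :: real fps"
  have "fps_deriv (geo m * ?u) = 1" using geo_times_denominator[OF assms] by simp
  then have "fps_deriv (geo m) * ?u = 1 + geo m" by (simp add: algebra_simps)
  then have "fps_XD (geo m) * ?u = fps_X * (1 + geo m)" by (simp add: fps_XD_def mult.assoc)
  also have "\<dots> = (geo m + geo m ^ 2) * ?u"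
    using geo_times_denominator[OF assms] by (simp add: power2_eq_square distrib_left distrib_right mult.assoc)
  finally show ?thesis using geo_denominator_nonzero[OF assms] by simp
qed

section \<open>Coefficientwise convergence\<close>

text \<open>
Convergence coefficient by coefficient in the usual topology of the reals. The metric topology on power series
is too strong for the purpose: there, convergent sequences have eventually constant coefficients.
\<close>

definition fps_tendsto :: "(nat \<Rightarrow> real fps) \<Rightarrow> real fps \<Rightarrow> bool" where
  "fps_tendsto F G \<longleftrightarrow> (\<forall>j. (\<lambda>N. F N $ j) \<longlonglongrightarrow> G $ j)"

lemma fps_tendsto_unique: "fps_tendsto F G \<Longrightarrow> fps_tendsto F H \<Longrightarrow> G = H"
  unfolding fps_tendsto_def fps_eq_iff using LIMSEQ_unique by blast

lemma fps_tendsto_const: "fps_tendsto (\<lambda>N. c) c"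
  by (simp add: fps_tendsto_def)

lemma fps_tendsto_add: "fps_tendsto F G \<Longrightarrow> fps_tendsto F' G' \<Longrightarrow> fps_tendsto (\<lambda>N. F N + F' N) (G + G')"
  unfolding fps_tendsto_def by (simp add: tendsto_add)

lemma fps_tendsto_diff: "fps_tendsto F G \<Longrightarrow> fps_tendsto F' G' \<Longrightarrow> fps_tendsto (\<lambda>N. F N - F' N) (G - G')"
  unfolding fps_tendsto_def by (simp add: tendsto_diff)

lemma fps_tendsto_mult: "fps_tendsto F G \<Longrightarrow> fps_tendsto F' G' \<Longrightarrow> fps_tendsto (\<lambda>N. F N * F' N) (G * G')"
  unfolding fps_tendsto_def fps_mult_nth by (intro allI tendsto_sum tendsto_mult; blast)

lemma fps_tendsto_power: "fps_tendsto F G \<Longrightarrow> fps_tendsto (\<lambda>N. F N ^ k) (G ^ k)"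
  by (induction k) (auto intro: fps_tendsto_const fps_tendsto_mult)

lemma fps_tendsto_XD: "fps_tendsto F G \<Longrightarrow> fps_tendsto (\<lambda>N. fps_XD (F N)) (fps_XD G)"
  unfolding fps_tendsto_def fps_XD_def o_def fps_mult_fps_X_deriv_shift by (simp add: tendsto_mult_left)

lemmas fps_tendsto_intros = fps_tendsto_const fps_tendsto_add fps_tendsto_diff fps_tendsto_mult fps_tendsto_power fps_tendsto_XD

section \<open>Sums of reciprocals of differences of squares\<close>

lemma telescope_gap:
  fixes f :: "nat \<Rightarrow> real"
  shows "(\<Sum>i<N. f i - f (i + m)) = (\<Sum>i<m. f i) - (\<Sum>i<m. f (N + i))"
proof -
  have "(\<Sum>i<N. f (i + m)) + (\<Sum>i<m. f i) = (\<Sum>i<N+m. f i)"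
    by (induction N) auto
  moreover have "(\<Sum>i<N+m. f i) = (\<Sum>i<N. f i) + (\<Sum>i<m. f (N + i))"
    by (induction m) (auto simp: algebra_simps)
  ultimately show ?thesis by (simp add: sum_subtractf)
qed

text \<open>
The denominators \<open>1 - m, 3 - m, \<dots>, m - 1\<close> are symmetric about 0. If \<open>m\<close> is odd, one of them is 0 and
contributes \<open>1 / 0 = 0\<close>.
\<close>

lemma sum_recip_odd_centred: "(\<Sum>i<m. 1 / (real (2 * i + 1) - real m)) = 0"
proof -
  have "(\<Sum>i<m. 1 / (real (2 * i + 1) - real m)) = (\<Sum>i<m. 1 / (real (2 * (m - Suc i) + 1) - real m))"
    by (rule sum.nat_diff_reindex[symmetric])
  also have "\<dots> = (\<Sum>i<m. - (1 / (real (2 * i + 1) - real m)))"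
  proof (rule sum.cong, goal_cases)
    case (2 i)
    then have "real (2 * (m - Suc i) + 1) - real m = - (real (2 * i + 1) - real m)"
      by (simp add: of_nat_diff algebra_simps)
    then show ?case by (metis divide_minus_right)
  qed simp
  finally show ?thesis by (simp add: sum_negf)
qed

text \<open>
The denominators are \<open>2 - m, 4 - m, \<dots>, m\<close>; all but the last one are symmetric about 0.
\<close>

lemma sum_recip_even_centred:
  assumes "m > 0" shows "(\<Sum>i<m. 1 / (real (2 * i + 2) - real m)) = 1 / real m"
proof -
  obtain l where l: "m = Suc l" using assms by (cases m) auto
  have "(\<Sum>i<m. 1 / (real (2 * i + 2) - real m)) = (\<Sum>i<l. 1 / (real (2 * i + 1) - real l)) + 1 / real m"
    unfolding l by (simp add: algebra_simps)
  then show ?thesis by (simp only: sum_recip_odd_centred add_0)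
qed

text \<open>
Since \<open>2m / (k\<^sup>2 - m\<^sup>2) = 1 / (k - m) - 1 / (k + m)\<close>, and \<open>k + m\<close> is \<open>m\<close> steps of size 2 beyond
\<open>k - m\<close>, the series telescopes to its first \<open>m\<close> terms. The convention \<open>1 / 0 = 0\<close> drops the term
\<open>k = m\<close> on the left; on the right it only removes \<open>1 / (k - m)\<close> and leaves \<open>- 1 / (2m)\<close>, which the last
summand corrects.
\<close>

lemma recip_diff_squares_limit:
  fixes r m :: nat
  assumes "m > 0"
  shows "(\<lambda>N. \<Sum>i<N. 1 / (real (2 * i + r) ^ 2 - real m ^ 2)) \<longlonglongrightarrow>
    (\<Sum>i<m. 1 / (real (2 * i + r) - real m)) / (2 * real m)
      + (if \<exists>i. m = 2 * i + r then 1 / (4 * real m ^ 2) else 0)"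
proof -
  define f where "f i = 1 / (real (2 * i + r) - real m)" for i
  define g where "g i = (if m = 2 * i + r then 1 / (4 * real m ^ 2) else 0)" for i
  have f0: "f \<longlonglongrightarrow> 0" 
  proof (rule Lim_null_comparison[OF _ LIMSEQ_inverse_real_of_nat])
    have "norm (f i) \<le> inverse (real (Suc i))" if "i > m" for i
    proof -
      have "real (Suc i) \<le> real (2 * i + r) - real m" using that by linarith
      then show ?thesis by (simp add: f_def divide_inverse)
    qed
    then show "\<forall>\<^sub>F i in sequentially. norm (f i) \<le> inverse (real (Suc i))"
      by (rule eventually_mono[OF eventually_gt_at_top])
  qed
  have summand: "1 / (real (2 * i + r) ^ 2 - real m ^ 2) = (f i - f (i + m)) / (2 * real m) + g i" for i
  proof (cases "m = 2 * i + r")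
    case True
    then show ?thesis using assms
      by (simp add: f_def g_def field_simps power2_eq_square)
  next
    case False
    have 1: "real (2 * i + r) - real m \<noteq> 0" using False by linarith
    have 2: "real (2 * i + r) + real m \<noteq> 0" using assms by linarith
    let ?x = "real (2 * i + r) - real m" and ?y = "real (2 * i + r) + real m"
    have "real (2 * i + r) ^ 2 - real m ^ 2 = ?x * ?y"
      by (simp only: power2_eq_square) (simp only: algebra_simps)
    also have "1 / (?x * ?y) = (1 / ?x - 1 / ?y) / (?y - ?x)"
      using 1 2 assms by (simp add: diff_frac_eq)
    also have "1 / ?y = f (i + m)"
      unfolding f_def by (rule arg_cong[where f = "\<lambda>z. 1 / z"]) simp
    also have "1 / ?x = f i" by (simp only: f_def)
    also have "?y - ?x = 2 * real m" by simp
    finally show ?thesis using False by (simp only: g_def if_False add_0_right)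
  qed
  have g: "(\<lambda>N. \<Sum>i<N. g i) \<longlonglongrightarrow> (if \<exists>i. m = 2 * i + r then 1 / (4 * real m ^ 2) else 0)"
  proof (cases "\<exists>i. m = 2 * i + r")
    case True
    then obtain i where i: "m = 2 * i + r" by auto
    have "g = (\<lambda>j. if j = i then (\<lambda>_. 1 / (4 * real m ^ 2)) j else 0)" by (auto simp: g_def i fun_eq_iff)
    then have "g sums (1 / (4 * real m ^ 2))" using sums_single[of i "\<lambda>_. 1 / (4 * real m ^ 2)"] by simp
    then show ?thesis using True by (simp add: sums_def)
  next
    case False
    then have "g = (\<lambda>i. 0)" by (auto simp: g_def)
    then show ?thesis using False by auto
  qed
  have "(\<lambda>N. ((\<Sum>i<m. f i) - (\<Sum>i<m. f (N + i))) / (2 * real m) + (\<Sum>i<N. g i)) \<longlonglongrightarrow>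
     ((\<Sum>i<m. f i) - (\<Sum>i<m. 0)) / (2 * real m) + (if \<exists>i. m = 2 * i + r then 1 / (4 * real m ^ 2) else 0)"
    using assms by (intro tendsto_intros g LIMSEQ_ignore_initial_segment[OF f0]) auto
  moreover have "(\<Sum>i<N. 1 / (real (2 * i + r) ^ 2 - real m ^ 2)) =
     ((\<Sum>i<m. f i) - (\<Sum>i<m. f (N + i))) / (2 * real m) + (\<Sum>i<N. g i)" for N
    unfolding summand sum.distrib sum_divide_distrib[symmetric] telescope_gap ..
  ultimately show ?thesis by (simp add: f_def)
qed

lemma summable_inverse_power_Suc:
  assumes "k \<ge> 2"
  shows "summable (\<lambda>i. 1 / real (Suc i) ^ k)"
  using inverse_power_summable[of k, where 'a = real] assms
  by (subst summable_Suc_iff[where f = "\<lambda>i. 1 / real i ^ k"]) (simp add: divide_inverse)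

text \<open>
Because \<open>\<bar>k\<^sup>2 - m\<^sup>2\<bar> \<ge> (k - m)\<^sup>2\<close>, the terms on either side of \<open>m\<close> are dominated by \<open>1 / d\<^sup>2\<close> with
distinct \<open>d\<close>. What matters is that the bound does not depend on \<open>m\<close>: it is the dominating constant for
exchanging limits below.
\<close>

lemma sum_recip_diff_squares_bound:
  assumes "finite K" "m > 0"
  shows "(\<Sum>k\<in>K. \<bar>1 / (real k ^ 2 - real m ^ 2)\<bar>) \<le> 2 * (\<Sum>j. 1 / real (Suc j) ^ 2)"
proof -
  define h where "h j = 1 / real (Suc j) ^ 2" for j
  define t where "t k = \<bar>1 / (real k ^ 2 - real m ^ 2)\<bar>" for k
  have "summable h"
    unfolding h_def by (rule summable_inverse_power_Suc) simp
  moreover have "0 \<le> h j" for j by (simp add: h_def)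
  ultimately have sum_h: "(\<Sum>j\<in>J. h j) \<le> suminf h" if "finite J" for J
    using that by (intro sum_le_suminf) auto
  \<comment> \<open>The shift by one, \<open>Suc d\<close>, only reflects that \<open>h\<close> is indexed from 0.\<close>
  have sq: "real (Suc d) ^ 2 \<le> \<bar>real k ^ 2 - real m ^ 2\<bar>" if "real (Suc d) = \<bar>real k - real m\<bar>" for k d
  proof -
    have "\<bar>real k - real m\<bar> * \<bar>real k - real m\<bar> \<le> \<bar>real k - real m\<bar> * (real k + real m)"
      by (intro mult_left_mono) auto
    also have "\<dots> = \<bar>(real k - real m) * (real k + real m)\<bar>" by (simp add: abs_mult)
    also have "(real k - real m) * (real k + real m) = real k ^ 2 - real m ^ 2"
      by (simp add: power2_eq_square algebra_simps)
    finally show ?thesis unfolding that by (simp add: power2_eq_square)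
  qed
  have t_le: "t k \<le> h d" if "real (Suc d) = \<bar>real k - real m\<bar>" for k d
  proof -
    have "1 / \<bar>real k ^ 2 - real m ^ 2\<bar> \<le> 1 / real (Suc d) ^ 2"
      using sq[OF that] by (intro divide_left_mono) (auto intro!: mult_pos_pos)
    then show ?thesis by (simp only: t_def h_def abs_divide abs_one)
  qed
  let ?A = "{k \<in> K. k < m}" and ?B = "{k \<in> K. m < k}"
  have "(\<Sum>k\<in>?A. t k) \<le> (\<Sum>k\<in>?A. h (m - k - 1))"
    by (intro sum_mono t_le) auto
  also have "\<dots> = (\<Sum>j\<in>(\<lambda>k. m - k - 1) ` ?A. h j)"
    by (subst sum.reindex) (auto simp: inj_on_def)
  also have "\<dots> \<le> suminf h" using assms by (intro sum_h) auto
  finally have A: "(\<Sum>k\<in>?A. t k) \<le> suminf h" .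
  have "(\<Sum>k\<in>?B. t k) \<le> (\<Sum>k\<in>?B. h (k - m - 1))"
    by (intro sum_mono t_le) auto
  also have "\<dots> = (\<Sum>j\<in>(\<lambda>k. k - m - 1) ` ?B. h j)"
    by (subst sum.reindex) (auto simp: inj_on_def)
  also have "\<dots> \<le> suminf h" using assms by (intro sum_h) auto
  finally have B: "(\<Sum>k\<in>?B. t k) \<le> suminf h" .
  have "(\<Sum>k\<in>K. t k) = (\<Sum>k\<in>?A \<union> ?B. t k)"
    using assms by (intro sum.mono_neutral_right) (auto simp: t_def)
  also have "\<dots> = (\<Sum>k\<in>?A. t k) + (\<Sum>k\<in>?B. t k)"
    using assms by (intro sum.union_disjoint) auto
  finally show ?thesis using A B unfolding t_def h_def by linarith
qed

text \<open>
A form of Tannery's theorem in which one parameter governs both the range of summation and the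
weights.
\<close>

lemma tendsto_sum_bounded_weights:
  fixes c :: "nat \<Rightarrow> real"
  assumes c: "summable (\<lambda>i. \<bar>c i\<bar>)"
    and bound: "\<And>N i. \<bar>S N i\<bar> \<le> B"
    and lim: "\<And>i. (\<lambda>N. S N i) \<longlonglongrightarrow> s i"
  shows "(\<lambda>N. \<Sum>i<N. c i * S N i) \<longlonglongrightarrow> (\<Sum>i. c i * s i)"
proof -
  define a where "a i N = (if i < N then c i * S N i else 0)" for i N
  have "(\<lambda>N. \<Sum>i. a i N) \<longlonglongrightarrow> (\<Sum>i. c i * s i)"
  proof (rule tannerys_theorem[THEN conjunct2, THEN conjunct2])
    show "(\<lambda>N. a i N) \<longlonglongrightarrow> c i * s i" for i
    proof (rule Lim_transform_eventually)
      show "(\<lambda>N. c i * S N i) \<longlonglongrightarrow> c i * s i" by (intro tendsto_intros lim)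
      show "\<forall>\<^sub>F N in sequentially. c i * S N i = a i N"
        using eventually_gt_at_top[of i] by eventually_elim (simp add: a_def)
    qed
    have "B \<ge> 0" using bound[of 0 0] by linarith
    then have "norm (a i N) \<le> \<bar>c i\<bar> * B" for i N
      using bound by (auto simp: a_def abs_mult intro: mult_left_mono)
    then show "\<forall>\<^sub>F (i, N) in sequentially \<times>\<^sub>F sequentially. norm (a i N) \<le> \<bar>c i\<bar> * B"
      by (intro always_eventually) auto
    show "summable (\<lambda>i. \<bar>c i\<bar> * B)" using c by (rule summable_mult2)
  qed simp
  moreover have "(\<Sum>i. a i N) = (\<Sum>i<N. c i * S N i)" for N
    by (subst suminf_finite[of "{..<N}"]) (auto simp: a_def)
  ultimately show ?thesis by simp
qed

section \<open>Power sums over the even and the odd numbers\<close>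

text \<open>
The sum over the first \<open>N\<close> terms of the arithmetic progression \<open>r, r + 2, r + 4, \<dots>\<close>: for \<open>r = 1\<close> it runs over
the odd numbers, for \<open>r = 2\<close> over the positive even ones.
\<close>

definition ap_sum :: "nat \<Rightarrow> nat \<Rightarrow> nat \<Rightarrow> real fps" where
  "ap_sum r k N = (\<Sum>i<N. geo (2 * i + r) ^ k)"

definition ap_series :: "nat \<Rightarrow> real fps" where
  "ap_series r = Abs_fps (\<lambda>j. if j = 0 then 0 else \<Sum>i. 1 / real (2 * i + r) ^ (2 * j))"

lemma ap_series_nth: "ap_series r $ j = (if j = 0 then 0 else \<Sum>i. 1 / real (2 * i + r) ^ (2 * j))"
  by (simp add: ap_series_def)

lemma summable_ap:
  assumes "r > 0" "j > 0"
  shows "summable (\<lambda>i. 1 / real (2 * i + r) ^ (2 * j))"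
proof (rule summable_comparison_test')
  show "summable (\<lambda>i. 1 / real (Suc i) ^ 2)"
    by (simp only: summable_inverse_power_Suc order.refl)
  fix i :: nat
  have "real (Suc i) ^ 2 \<le> real (Suc i) ^ (2 * j)" using assms by (intro power_increasing) auto
  also have "\<dots> \<le> real (2 * i + r) ^ (2 * j)" using assms by (intro power_mono) auto
  finally have "1 / real (2 * i + r) ^ (2 * j) \<le> 1 / real (Suc i) ^ 2"
    using assms by (intro divide_left_mono) (auto intro!: mult_pos_pos)
  then show "norm (1 / real (2 * i + r) ^ (2 * j)) \<le> 1 / real (Suc i) ^ 2" by simp
qed

lemma ap_sum_1_tendsto:
  assumes "r > 0"
  shows "fps_tendsto (ap_sum r 1) (ap_series r)"
  unfolding fps_tendsto_def
proof
  fix j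
  show "(\<lambda>N. ap_sum r 1 N $ j) \<longlonglongrightarrow> ap_series r $ j"
    using summable_LIMSEQ[OF summable_ap[OF assms, of j]]
    by (cases "j = 0") (simp_all add: ap_sum_def fps_sum_nth geo_nth ap_series_nth)
qed

lemma fps_XD_ap_sum_1:
  assumes "r > 0"
  shows "fps_XD (ap_sum r 1 N) = ap_sum r 1 N + ap_sum r 2 N"
  by (induction N) (use assms in \<open>simp_all add: ap_sum_def fps_XD_geo, simp add: fps_XD_def\<close>)

lemma fps_XD_ap_sum_2:
  assumes "r > 0"
  shows "fps_XD (ap_sum r 2 N) = 2 * ap_sum r 2 N + 2 * ap_sum r 3 N"
proof -
  have "fps_XD (geo m ^ 2) = 2 * geo m ^ 2 + 2 * geo m ^ 3" if "m > 0" for m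
  proof -
    have "fps_XD (geo m ^ 2) = 2 * geo m * fps_XD (geo m)"
      by (simp add: fps_XD_def power2_eq_square algebra_simps)
    also have "\<dots> = 2 * geo m ^ 2 + 2 * geo m ^ 3"
      using that by (simp add: fps_XD_geo power2_eq_square power3_eq_cube algebra_simps)
    finally show ?thesis .
  qed
  then show ?thesis
    by (induction N) (use assms in \<open>simp_all add: ap_sum_def algebra_simps, simp add: fps_XD_def\<close>)
qed

definition recip_sum :: "nat \<Rightarrow> nat \<Rightarrow> nat \<Rightarrow> real" where
  "recip_sum r N m = (\<Sum>i<N. 1 / (real (2 * i + r) ^ 2 - real m ^ 2))"

lemma recip_sum_bound:
  assumes "m > 0"
  shows "\<bar>recip_sum r N m\<bar> \<le> 2 * (\<Sum>j. 1 / real (Suc j) ^ 2)"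
proof -
  have "\<bar>recip_sum r N m\<bar> \<le> (\<Sum>i<N. \<bar>1 / (real (2 * i + r) ^ 2 - real m ^ 2)\<bar>)"
    unfolding recip_sum_def by (rule sum_abs)
  also have "\<dots> = (\<Sum>k\<in>(\<lambda>i. 2 * i + r) ` {..<N}. \<bar>1 / (real k ^ 2 - real m ^ 2)\<bar>)"
    by (subst sum.reindex) (auto simp: inj_on_def)
  also have "\<dots> \<le> 2 * (\<Sum>j. 1 / real (Suc j) ^ 2)"
    using assms by (intro sum_recip_diff_squares_bound) auto
  finally show ?thesis .
qed

text \<open>
If \<open>m\<close> has the parity of the summation index, the omitted term \<open>k = m\<close> contributes \<open>1/4\<close>; summing over even
indices contributes another \<open>1/2\<close>.
\<close>

lemma recip_sum_limits:
  "(\<lambda>N. recip_sum 1 N (2 * i + 1)) \<longlonglongrightarrow> (1 / 4) / real (2 * i + 1) ^ 2"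
  "(\<lambda>N. recip_sum 1 N (2 * i + 2)) \<longlonglongrightarrow> 0 / real (2 * i + 2) ^ 2"
  "(\<lambda>N. recip_sum 2 N (2 * i + 1)) \<longlonglongrightarrow> (1 / 2) / real (2 * i + 1) ^ 2"
  "(\<lambda>N. recip_sum 2 N (2 * i + 2)) \<longlonglongrightarrow> (3 / 4) / real (2 * i + 2) ^ 2"
proof -
  have *: "(if \<exists>l. 2 * i + 1 = 2 * l + 2 then x else 0) = 0" "(if \<exists>l. 2 * i + 2 = 2 * l + 1 then x else 0) = 0"
      "(if \<exists>l. 2 * i + s = 2 * l + s then x else 0) = x" for x :: real and s :: nat
  proof -
    have "2 * i + 1 \<noteq> 2 * l + 2" "2 * i + 2 \<noteq> 2 * l + 1" for l by presburger+
    then show "(if \<exists>l. 2 * i + 1 = 2 * l + 2 then x else 0) = 0" "(if \<exists>l. 2 * i + 2 = 2 * l + 1 then x else 0) = 0"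
      by (simp_all only: simp_thms if_False)
  qed auto
  show "(\<lambda>N. recip_sum 1 N (2 * i + 1)) \<longlonglongrightarrow> (1 / 4) / real (2 * i + 1) ^ 2"
    using recip_diff_squares_limit[of "2 * i + 1" 1] unfolding recip_sum_def[symmetric] sum_recip_odd_centred * by simp
  show "(\<lambda>N. recip_sum 1 N (2 * i + 2)) \<longlonglongrightarrow> 0 / real (2 * i + 2) ^ 2"
    using recip_diff_squares_limit[of "2 * i + 2" 1] unfolding recip_sum_def[symmetric] sum_recip_odd_centred * by simp
  have even: "(\<Sum>i<m. 1 / (real (2 * i + 2) - real m)) / (2 * real m) = (1 / 2) / real m ^ 2" if "m > 0" for m
    using that by (subst sum_recip_even_centred) (auto simp: power2_eq_square)
  have quarter: "x / 2 / y + 1 / (4 * y) = (x / 2 + 1 / 4) / y" for x y :: real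
    by (simp add: add_divide_distrib)
  show "(\<lambda>N. recip_sum 2 N (2 * i + 1)) \<longlonglongrightarrow> (1 / 2) / real (2 * i + 1) ^ 2"
    using recip_diff_squares_limit[of "2 * i + 1" 2] even[of "2 * i + 1"]
    unfolding recip_sum_def[symmetric] * by simp
  show "(\<lambda>N. recip_sum 2 N (2 * i + 2)) \<longlonglongrightarrow> (3 / 4) / real (2 * i + 2) ^ 2"
    using recip_diff_squares_limit[of "2 * i + 2" 2] even[of "2 * i + 2"]
    unfolding recip_sum_def[symmetric] * quarter[of 1] by simp
qed

text \<open>
One half of the off-diagonal part of a product of two sums of geometric series, after partial fractions: the
inner sum over the progression \<open>r\<close> has become the weight.
\<close>

definition weighted_geo_sum :: "nat \<Rightarrow> nat \<Rightarrow> nat \<Rightarrow> real fps" where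
  "weighted_geo_sum r s N = (\<Sum>i<N. fps_const (recip_sum r N (2 * i + s)) * (fps_X * geo (2 * i + s)))"

text \<open>
The limiting weight \<open>c / m\<^sup>2\<close> undoes the multiplication by \<open>t\<close>, as
\<open>t x\<^sub>m / m\<^sup>2 = x\<^sub>m - t / m\<^sup>2\<close>; this is why the limit is \<open>c\<close> times the original series without its linear
term.
\<close>

lemma weighted_geo_sum_tendsto:
  assumes "s > 0" and c: "\<And>i. (\<lambda>N. recip_sum r N (2 * i + s)) \<longlonglongrightarrow> c / real (2 * i + s) ^ 2"
  shows "fps_tendsto (weighted_geo_sum r s)
    (fps_const c * (ap_series s - fps_const (ap_series s $ 1) * fps_X))"
  unfolding fps_tendsto_def
proof
  fix j
  consider "j = 0" | "j = 1" | l where "j = Suc l" "l > 0" by (metis One_nat_def not0_implies_Suc not_gr0)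
  then show "(\<lambda>N. weighted_geo_sum r s N $ j) \<longlonglongrightarrow>
     (fps_const c * (ap_series s - fps_const (ap_series s $ 1) * fps_X)) $ j"
  proof cases
    case (3 l)
    have "(\<lambda>N. \<Sum>i<N. (1 / real (2 * i + s) ^ (2 * l)) * recip_sum r N (2 * i + s)) \<longlonglongrightarrow>
        (\<Sum>i. (1 / real (2 * i + s) ^ (2 * l)) * (c / real (2 * i + s) ^ 2))"
      by (rule tendsto_sum_bounded_weights[OF _ recip_sum_bound c])
         (use summable_ap[of s l] assms 3 in auto)
    also have "(\<Sum>i. (1 / real (2 * i + s) ^ (2 * l)) * (c / real (2 * i + s) ^ 2)) =
        (\<Sum>i. c * (1 / real (2 * i + s) ^ (2 * j)))"
      using 3 by (intro suminf_cong) (simp add: power_add[symmetric])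
    also have "\<dots> = c * ap_series s $ j"
      using 3 suminf_mult[OF summable_ap[of s j], of c] assms by (simp add: ap_series_nth)
    finally show ?thesis
      using 3 by (simp add: weighted_geo_sum_def fps_sum_nth geo_nth mult.commute)
  qed (simp_all add: weighted_geo_sum_def fps_sum_nth geo_nth ap_series_nth)
qed

lemma fps_const_sum: "fps_const (\<Sum>i\<in>I. f i) = (\<Sum>i\<in>I. fps_const (f i))"
  by (induction I rule: infinite_finite_induct) (simp_all flip: fps_const_add)

lemma ap_sum_product:
  assumes "r \<in> {1, 2}" "s \<in> {1, 2}"
  shows "ap_sum r 1 N * ap_sum s 1 N =
    (if r = s then ap_sum r 2 N else 0) + weighted_geo_sum s r N + weighted_geo_sum r s N"
proof -
  define u where "u i l = fps_const (1 / (real (2 * l + s) ^ 2 - real (2 * i + r) ^ 2)) * (fps_X * geo (2 * i + r))" for i l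
  define v where "v i l = fps_const (1 / (real (2 * i + r) ^ 2 - real (2 * l + s) ^ 2)) * (fps_X * geo (2 * l + s))" for i l
  have eq_iff: "2 * i + r = 2 * l + s \<longleftrightarrow> r = s \<and> i = l" for i l
    using assms by (simp only: insert_iff empty_iff) presburger
  have "geo (2 * i + r) * geo (2 * l + s) =
      (if i = l then if r = s then geo (2 * i + r) ^ 2 else 0 else 0) + u i l + v i l" for i l
  proof (cases "2 * i + r = 2 * l + s")
    case True
    then show ?thesis using eq_iff[of i l] by (simp add: u_def v_def power2_eq_square)
  next
    case False
    have "v i l = - (fps_const (1 / (real (2 * l + s) ^ 2 - real (2 * i + r) ^ 2)) * (fps_X * geo (2 * l + s)))"
      unfolding v_def minus_mult_left fps_const_neg minus_divide_right minus_diff_eq ..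
    moreover have "geo (2 * i + r) * geo (2 * l + s) =
        fps_const (1 / (real (2 * l + s) ^ 2 - real (2 * i + r) ^ 2)) * (fps_X * (geo (2 * i + r) - geo (2 * l + s)))"
      using assms False by (intro geo_mult) auto
    ultimately have "geo (2 * i + r) * geo (2 * l + s) = u i l + v i l"
      by (simp only: u_def right_diff_distrib) (simp only: diff_conv_add_uminus)
    then show ?thesis using False eq_iff[of i l] by auto
  qed
  then have "ap_sum r 1 N * ap_sum s 1 N =
     (\<Sum>i<N. \<Sum>l<N. (if i = l then if r = s then geo (2 * i + r) ^ 2 else 0 else 0) + u i l + v i l)"
    by (simp add: ap_sum_def sum_product)
  also have "\<dots> = (if r = s then ap_sum r 2 N else 0) + (\<Sum>i<N. \<Sum>l<N. u i l) + (\<Sum>l<N. \<Sum>i<N. v i l)"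
    using sum.swap[of v "{..<N}" "{..<N}"] by (simp add: sum.distrib ap_sum_def)
  also have "(\<Sum>i<N. \<Sum>l<N. u i l) = weighted_geo_sum s r N"
    unfolding u_def weighted_geo_sum_def recip_sum_def fps_const_sum sum_distrib_right ..
  also have "(\<Sum>l<N. \<Sum>i<N. v i l) = weighted_geo_sum r s N"
    unfolding v_def weighted_geo_sum_def recip_sum_def fps_const_sum sum_distrib_right ..
  finally show ?thesis .
qed

abbreviation "even_series \<equiv> ap_series 2"
abbreviation "odd_series \<equiv> ap_series 1"

lemma ap_sum_2_tendsto:
  assumes "r > 0"
  shows "fps_tendsto (ap_sum r 2) (fps_XD (ap_series r) - ap_series r)"
proof -
  have "ap_sum r 2 = (\<lambda>N. fps_XD (ap_sum r 1 N) - ap_sum r 1 N)"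
    using fps_XD_ap_sum_1[OF assms] by (simp add: fun_eq_iff)
  then show ?thesis using assms by (simp only:) (intro fps_tendsto_intros ap_sum_1_tendsto)
qed

lemma ap_sum_3_tendsto:
  assumes "r > 0"
  shows "fps_tendsto (\<lambda>N. 2 * ap_sum r 3 N)
     (fps_XD (fps_XD (ap_series r) - ap_series r) - 2 * (fps_XD (ap_series r) - ap_series r))"
proof -
  have "(\<lambda>N. 2 * ap_sum r 3 N) = (\<lambda>N. fps_XD (ap_sum r 2 N) - 2 * ap_sum r 2 N)"
    using fps_XD_ap_sum_2[OF assms] by (simp add: fun_eq_iff)
  then show ?thesis using assms by (simp only:) (intro fps_tendsto_intros ap_sum_2_tendsto)
qed

text \<open>
The diagonal of the double sum gives the power sum of order 2, which is \<open>fps_XD f - f\<close> for \<open>f\<close> the power sum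
of order 1; the rest is given by \<open>recip_sum_limits\<close>. In the mixed product there is no diagonal, and one of the
two limiting weights vanishes.
\<close>

lemma ap_series_product:
  "odd_series ^ 2 = fps_XD odd_series - odd_series + fps_const (1 / 2) * (odd_series - fps_const (odd_series $ 1) * fps_X)"
  "even_series ^ 2 = fps_XD even_series - even_series + fps_const (3 / 2) * (even_series - fps_const (even_series $ 1) * fps_X)"
  "even_series * odd_series = fps_const (1 / 2) * (odd_series - fps_const (odd_series $ 1) * fps_X)"
proof -
  have gen: "ap_series r * ap_series s = (if r = s then fps_XD (ap_series r) - ap_series r else 0)
      + fps_const c * (ap_series r - fps_const (ap_series r $ 1) * fps_X)
      + fps_const d * (ap_series s - fps_const (ap_series s $ 1) * fps_X)"
    if rs: "r \<in> {1, 2}" "s \<in> {1, 2}"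
      and c: "\<And>i. (\<lambda>N. recip_sum s N (2 * i + r)) \<longlonglongrightarrow> c / real (2 * i + r) ^ 2"
      and d: "\<And>i. (\<lambda>N. recip_sum r N (2 * i + s)) \<longlonglongrightarrow> d / real (2 * i + s) ^ 2"
    for r s c d
  proof (rule fps_tendsto_unique)
    have pos: "r > 0" "s > 0" using rs by auto
    show "fps_tendsto (\<lambda>N. ap_sum r 1 N * ap_sum s 1 N) (ap_series r * ap_series s)"
      by (intro fps_tendsto_intros ap_sum_1_tendsto pos)
    have "fps_tendsto (\<lambda>N. if r = s then ap_sum r 2 N else 0) (if r = s then fps_XD (ap_series r) - ap_series r else 0)"
      using ap_sum_2_tendsto[OF pos(1)] by (auto intro: fps_tendsto_const)
    then show "fps_tendsto (\<lambda>N. ap_sum r 1 N * ap_sum s 1 N) ((if r = s then fps_XD (ap_series r) - ap_series r else 0)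
      + fps_const c * (ap_series r - fps_const (ap_series r $ 1) * fps_X)
      + fps_const d * (ap_series s - fps_const (ap_series s $ 1) * fps_X))"
      unfolding ap_sum_product[OF rs] by (intro fps_tendsto_add weighted_geo_sum_tendsto pos c d)
  qed
  have double: "fps_const (x / 2) * f + fps_const (x / 2) * f = fps_const x * f" for x :: real and f
    by (simp flip: distrib_right)
  show "odd_series ^ 2 = fps_XD odd_series - odd_series + fps_const (1 / 2) * (odd_series - fps_const (odd_series $ 1) * fps_X)"
    using gen[OF _ _ recip_sum_limits(1,1)] double[of "1 / 2" "odd_series - fps_const (odd_series $ 1) * fps_X"]
    by (simp add: power2_eq_square add.assoc)
  show "even_series ^ 2 = fps_XD even_series - even_series + fps_const (3 / 2) * (even_series - fps_const (even_series $ 1) * fps_X)"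
    using gen[OF _ _ recip_sum_limits(4,4)] double[of "3 / 2" "even_series - fps_const (even_series $ 1) * fps_X"]
    by (simp add: power2_eq_square add.assoc)
  show "even_series * odd_series = fps_const (1 / 2) * (odd_series - fps_const (odd_series $ 1) * fps_X)"
    using gen[OF _ _ recip_sum_limits(2,3)] by simp
qed

section \<open>Zeta values and the relations between the power sums\<close>

lemma zeta_conv_ap_series:
  assumes "j > 0"
  shows "zeta (2 * j) = even_series $ j + odd_series $ j" "zeta_bar (2 * j) = even_series $ j - odd_series $ j"
    "4 ^ j * even_series $ j = zeta (2 * j)"
proof -
  define f where "f k = 1 / real (Suc k) ^ (2 * j)" for k
  have "2 \<le> 2 * j" using assms by simp
  then have f: "summable f"
    unfolding f_def by (rule summable_inverse_power_Suc)
  have sign: "(-1 :: real) ^ (i + i) = 1" for i by (simp flip: mult_2)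
  have even: "(\<lambda>i. f (2 * i + 1)) sums (even_series $ j)" and odd: "(\<lambda>i. f (2 * i)) sums (odd_series $ j)"
    using summable_ap[of 2 j] summable_ap[of 1 j] assms
    by (auto simp: f_def ap_series_nth add.commute dest: summable_sums)
  have "f sums zeta (2 * j)"
    unfolding zeta_def f_def[symmetric] by (rule summable_sums[OF f])
  from sums_group[OF this, of 2] have "(\<lambda>i. f (2 * i + 1) + f (2 * i)) sums zeta (2 * j)"
    by (simp add: numeral_2_eq_2 ac_simps)
  with sums_add[OF even odd] show "zeta (2 * j) = even_series $ j + odd_series $ j" by (rule sums_unique2[symmetric])
  have "summable (\<lambda>k. (-1) ^ Suc k * f k)"
  proof (rule summable_rabs_cancel)
    have "\<bar>(-1) ^ Suc k * f k\<bar> = f k" for k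
      unfolding abs_mult power_abs by (simp add: f_def)
    then show "summable (\<lambda>k. \<bar>(-1) ^ Suc k * f k\<bar>)" using f by (simp only:)
  qed
  moreover have "zeta_bar (2 * j) = (\<Sum>k. (-1) ^ Suc k * f k)"
    unfolding zeta_bar_def f_def by (simp only: times_divide_eq_right mult_1_right)
  ultimately have "(\<lambda>k. (-1) ^ Suc k * f k) sums zeta_bar (2 * j)"
    by (simp only: summable_sums)
  from sums_group[OF this, of 2] have "(\<lambda>i. f (2 * i + 1) - f (2 * i)) sums zeta_bar (2 * j)"
    using sign by (simp add: numeral_2_eq_2 ac_simps)
  with sums_diff[OF even odd] show "zeta_bar (2 * j) = even_series $ j - odd_series $ j" by (rule sums_unique2[symmetric])
  have "(\<lambda>i. 4 ^ j * f (2 * i + 1)) sums (4 ^ j * even_series $ j)" by (rule sums_mult[OF even])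
  moreover have "4 ^ j * f (2 * i + 1) = f i" for i
  proof -
    have "real (Suc (2 * i + 1)) = 2 * real (Suc i)" by simp
    moreover have "(2 :: real) ^ (2 * j) = 4 ^ j" by (simp add: power_mult)
    ultimately show ?thesis by (simp only: f_def power_mult_distrib) simp
  qed
  ultimately have "f sums (4 ^ j * even_series $ j)" by simp
  then show "4 ^ j * even_series $ j = zeta (2 * j)"
    unfolding zeta_def f_def[symmetric] by (rule sums_unique)
qed

lemma ap_series_first_coeff: "odd_series $ 1 = 3 * even_series $ 1"
  using zeta_conv_ap_series[of 1] by simp

text \<open>
The product formulas with denominators cleared and both linear terms written through \<open>T\<close>, together with the derivatives of the
first two, which bring in the power sums of order 3.
\<close>

lemma ap_series_relations:
  defines "T \<equiv> fps_const (even_series $ 1) * fps_X"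
  shows "2 * even_series ^ 2 = 2 * (fps_XD even_series - even_series) + 3 * (even_series - T)" (is ?PP)
    and "2 * odd_series ^ 2 = 2 * (fps_XD odd_series - odd_series) + (odd_series - 3 * T)" (is ?QQ)
    and "2 * (even_series * odd_series) = odd_series - 3 * T"
    and "4 * even_series * fps_XD even_series = 2 * fps_XD (fps_XD even_series - even_series) + 3 * (fps_XD even_series - T)"
    and "4 * odd_series * fps_XD odd_series = 2 * fps_XD (fps_XD odd_series - odd_series) + (fps_XD odd_series - 3 * T)"
proof -
  have Q1: "fps_const (odd_series $ 1) * fps_X = 3 * T"
    unfolding ap_series_first_coeff T_def fps_const_mult[symmetric] by (simp add: numeral_fps_const mult.assoc)
  have double: "2 * (fps_const (c / 2) * f) = fps_const c * f" for c :: real and f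
    by (simp add: numeral_fps_const flip: mult.assoc)
  show PP: ?PP
    using double[of 3 "even_series - T"]
    unfolding ap_series_product(2) T_def by (simp add: numeral_fps_const distrib_left)
  show QQ: ?QQ
    using double[of 1 "odd_series - 3 * T"] unfolding ap_series_product(1) Q1 by (simp add: distrib_left)
  show "2 * (even_series * odd_series) = odd_series - 3 * T"
    using double[of 1 "odd_series - 3 * T"] unfolding ap_series_product(3) Q1 by simp
  have XD: "fps_XD (2 * f) = 2 * fps_XD f" "fps_XD (3 * f) = 3 * fps_XD f" "fps_XD (f - g) = fps_XD f - fps_XD g"
      "fps_XD (f ^ 2) = 2 * f * fps_XD f" "fps_XD T = T" for f g :: "real fps"
    by (simp_all add: fps_XD_def T_def power2_eq_square algebra_simps)
  show "4 * even_series * fps_XD even_series = 2 * fps_XD (fps_XD even_series - even_series) + 3 * (fps_XD even_series - T)"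
    using arg_cong[OF PP, of fps_XD] by (simp add: XD mult.assoc)
  show "4 * odd_series * fps_XD odd_series = 2 * fps_XD (fps_XD odd_series - odd_series) + (fps_XD odd_series - 3 * T)"
    using arg_cong[OF QQ, of fps_XD] by (simp add: XD mult.assoc)
qed

text \<open>
Here \<open>p2\<close> and \<open>q2\<close> stand for the power sums of order 2, but \<open>p3\<close> and \<open>q3\<close> for twice those of order 3,
which keeps the relations integral. The relations express them, up to powers of 2, by \<open>P\<close>, \<open>Q\<close> and \<open>T\<close>. After that,
the two sides of either claim differ by a multiple of \<open>2 P Q - (Q - 3 T)\<close>; the cofactors 4 and \<open>-8\<close> are
found by comparing coefficients of \<open>T\<close>.
\<close>

lemma power_sum_relations:
  fixes P Q T p2 q2 p3 q3 DP DQ :: "'a :: comm_ring_1"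
  assumes "2 * P ^ 2 = 2 * p2 + 3 * (P - T)"
    and "2 * Q ^ 2 = 2 * q2 + (Q - 3 * T)"
    and PQ: "2 * (P * Q) = Q - 3 * T"
    and "DP = P + p2" "DQ = Q + q2"
    and p3: "4 * P * DP = 2 * (2 * p2 + p3) + 3 * (DP - T)"
    and q3: "4 * Q * DQ = 2 * (2 * q2 + q3) + (DQ - 3 * T)"
  shows "8 * ((P - Q) * (P + Q) ^ 2 - 2 * (p2 - q2) * (P + Q) - (p2 + q2) * (P - Q) + (p3 - q3))
          = 2 * (15 * P - Q - 12 * T)"
    and "8 * ((P + Q) * (P - Q) ^ 2 - 2 * (p2 - q2) * (P - Q) - (p2 + q2) * (P + Q) + (p3 + q3))
          = 2 * (15 * P - Q - 12 * T)"
proof -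
  have A: "2 * p2 = 2 * P ^ 2 - 3 * (P - T)" and B: "2 * q2 = 2 * Q ^ 2 - (Q - 3 * T)"
    using assms(1,2) by (simp_all add: algebra_simps)
  have "4 * p3 = 2 * (4 * P * DP - 3 * (DP - T)) - 4 * (2 * p2)"
    unfolding p3 by (simp add: algebra_simps)
  also have "\<dots> = 8 * P ^ 2 + 4 * P * (2 * p2) - 7 * (2 * p2) - 6 * P + 6 * T"
    unfolding assms(4) by (simp add: algebra_simps power2_eq_square)
  finally have C: "4 * p3 = 8 * P ^ 2 + 4 * P * (2 * P ^ 2 - 3 * (P - T)) - 7 * (2 * P ^ 2 - 3 * (P - T)) - 6 * P + 6 * T"
    unfolding A .
  have "4 * q3 = 2 * (4 * Q * DQ - (DQ - 3 * T)) - 4 * (2 * q2)"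
    unfolding q3 by (simp add: algebra_simps)
  also have "\<dots> = 8 * Q ^ 2 + 4 * Q * (2 * q2) - 5 * (2 * q2) - 2 * Q + 6 * T"
    unfolding assms(5) by (simp add: algebra_simps power2_eq_square)
  finally have D: "4 * q3 = 8 * Q ^ 2 + 4 * Q * (2 * Q ^ 2 - (Q - 3 * T)) - 5 * (2 * Q ^ 2 - (Q - 3 * T)) - 2 * Q + 6 * T"
    unfolding B .
  have "8 * ((P - Q) * (P + Q) ^ 2 - 2 * (p2 - q2) * (P + Q) - (p2 + q2) * (P - Q) + (p3 - q3))
    = 8 * ((P - Q) * (P + Q) ^ 2) - 8 * (2 * p2 - 2 * q2) * (P + Q) - 4 * (2 * p2 + 2 * q2) * (P - Q)
      + 2 * (4 * p3 - 4 * q3)"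
    by (simp add: algebra_simps)
  also have "\<dots> = 2 * (15 * P - Q - 12 * T) + 4 * (2 * (P * Q) - (Q - 3 * T))"
    unfolding A B C D by (simp add: algebra_simps power2_eq_square)
  finally show "8 * ((P - Q) * (P + Q) ^ 2 - 2 * (p2 - q2) * (P + Q) - (p2 + q2) * (P - Q) + (p3 - q3))
      = 2 * (15 * P - Q - 12 * T)"
    unfolding PQ by simp
  have "8 * ((P + Q) * (P - Q) ^ 2 - 2 * (p2 - q2) * (P - Q) - (p2 + q2) * (P + Q) + (p3 + q3))
    = 8 * ((P + Q) * (P - Q) ^ 2) - 8 * (2 * p2 - 2 * q2) * (P - Q) - 4 * (2 * p2 + 2 * q2) * (P + Q)
      + 2 * (4 * p3 + 4 * q3)"
    by (simp add: algebra_simps)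
  also have "\<dots> = 2 * (15 * P - Q - 12 * T) - 8 * (2 * (P * Q) - (Q - 3 * T))"
    unfolding A B C D by (simp add: algebra_simps power2_eq_square)
  finally show "8 * ((P + Q) * (P - Q) ^ 2 - 2 * (p2 - q2) * (P - Q) - (p2 + q2) * (P + Q) + (p3 + q3))
      = 2 * (15 * P - Q - 12 * T)"
    unfolding PQ by simp
qed

section \<open>Symmetric sums over decreasing triples\<close>

lemma sum_triangle_pair:
  fixes x y :: "nat \<Rightarrow> 'a :: comm_ring_1"
  shows "(\<Sum>a=1..N. \<Sum>b=1..a-1. x a * y b + y a * x b) = sum x {1..N} * sum y {1..N} - (\<Sum>a=1..N. x a * y a)"
proof -
  have "(\<Sum>b=1..a-1. x a * y b + y a * x b) = x a * sum y {1..a-1} + y a * sum x {1..a-1}" for a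
    by (simp add: sum.distrib sum_distrib_left)
  then have "(\<Sum>a=1..N. \<Sum>b=1..a-1. x a * y b + y a * x b) = (\<Sum>a=1..N. x a * sum y {1..a-1} + y a * sum x {1..a-1})"
    by simp
  also have "\<dots> = sum x {1..N} * sum y {1..N} - (\<Sum>a=1..N. x a * y a)"
    by (induction N) (simp_all add: algebra_simps)
  finally show ?thesis .
qed

text \<open>
Newton's identity for the third elementary symmetric function in polarized form. Setting two of the three
sequences equal gives the sums with one or with two signed factors.
\<close>

lemma sum_triangle_triple:
  fixes x y z :: "nat \<Rightarrow> 'a :: comm_ring_1"
  shows "(\<Sum>a=1..N. \<Sum>b=1..a-1. \<Sum>c=1..b-1.
           x a * (y b * z c + z b * y c) + y a * (x b * z c + z b * x c) + z a * (x b * y c + y b * x c))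
     = sum x {1..N} * sum y {1..N} * sum z {1..N}
       - (\<Sum>a=1..N. x a * y a) * sum z {1..N} - (\<Sum>a=1..N. x a * z a) * sum y {1..N}
       - (\<Sum>a=1..N. y a * z a) * sum x {1..N} + 2 * (\<Sum>a=1..N. x a * y a * z a)" (is "?L = ?R N")
proof -
  define u where "u a = x a * (sum y {1..a-1} * sum z {1..a-1} - (\<Sum>b=1..a-1. y b * z b))
      + y a * (sum x {1..a-1} * sum z {1..a-1} - (\<Sum>b=1..a-1. x b * z b))
      + z a * (sum x {1..a-1} * sum y {1..a-1} - (\<Sum>b=1..a-1. x b * y b))" for a
  have "?L = (\<Sum>a=1..N. u a)"
    unfolding u_def sum_triangle_pair[symmetric]
    by (simp only: sum.distrib sum_distrib_left distrib_left)
  also have "\<dots> = ?R N"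
    by (induction N) (simp_all add: u_def algebra_simps)
  finally show ?thesis .
qed

section \<open>Partial sums of Euler sums\<close>

lemma decr_tuples_0: "decr_tuples 0 N = {[]}"
  by (auto simp: decr_tuples_def)

lemma decr_tuples_Suc: "decr_tuples (Suc d) N = (\<Union>a\<in>{1..N}. (#) a ` decr_tuples d (a - 1))" (is "_ = ?R")
proof
  show "decr_tuples (Suc d) N \<subseteq> ?R"
  proof
    fix ns assume "ns \<in> decr_tuples (Suc d) N"
    then obtain a ms where ns: "ns = a # ms" "length ms = d" "sorted_wrt (>) ms" "\<forall>m\<in>set ms. m < a"
        "a \<in> {1..N}" "set ms \<subseteq> {1..N}"
      by (auto simp: decr_tuples_def length_Suc_conv)
    then have "ms \<in> decr_tuples d (a - 1)" by (fastforce simp: decr_tuples_def)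
    then show "ns \<in> ?R" using ns by auto
  qed
  show "?R \<subseteq> decr_tuples (Suc d) N" by (fastforce simp: decr_tuples_def)
qed

lemma finite_decr_tuples: "finite (decr_tuples d N)"
  by (induction d arbitrary: N) (auto simp: decr_tuples_0 decr_tuples_Suc)

lemma sum_decr_tuples_Suc:
  "sum f (decr_tuples (Suc d) N) = (\<Sum>a=1..N. \<Sum>ns\<in>decr_tuples d (a - 1). f (a # ns))"
  unfolding decr_tuples_Suc
  by (subst sum.UNION_disjoint) (auto simp: finite_decr_tuples sum.reindex)

definition euler_partial :: "nat list \<Rightarrow> real list \<Rightarrow> nat \<Rightarrow> real" where
  "euler_partial ss es N = (\<Sum>ns\<in>decr_tuples (length ss) N.
      \<Prod>i<length ss. (es ! i) ^ (ns ! i) / real (ns ! i) ^ (ss ! i))"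

lemma euler_partial_Cons:
  "euler_partial (s # ss) (e # es) N = (\<Sum>a=1..N. e ^ a / real a ^ s * euler_partial ss es (a - 1))"
  unfolding euler_partial_def
  by (simp add: sum_decr_tuples_Suc prod.lessThan_Suc_shift sum_distrib_left del: prod.lessThan_Suc)

text \<open>
The outermost summation has terms \<open>e\<^sup>a / a\<^sup>s\<close> times a partial sum of smaller depth. These partial sums converge by
induction, so they are bounded, and \<open>s \<ge> 2\<close> gives absolute convergence.
\<close>

lemma convergent_euler_partial:
  assumes "length es = length ss" "\<forall>s\<in>set ss. 2 \<le> s" "\<forall>e\<in>set es. \<bar>e\<bar> \<le> 1"
  shows "convergent (euler_partial ss es)"
  using assms
proof (induction es ss rule: list_induct2)
  case Nil
  then show ?case by (simp add: euler_partial_def decr_tuples_0 convergent_const)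
next
  case (Cons e es s ss)
  then have "Bseq (euler_partial ss es)" by (simp add: convergent_imp_Bseq)
  then obtain B where B: "\<And>N. \<bar>euler_partial ss es N\<bar> \<le> B"
    by (auto simp: Bseq_def)
  define t where "t a = e ^ Suc a / real (Suc a) ^ s * euler_partial ss es a" for a
  have "summable t"
  proof (rule summable_comparison_test')
    show "summable (\<lambda>a. 1 / real (Suc a) ^ 2 * B)"
      by (intro summable_mult2 summable_inverse_power_Suc) simp
    fix a
    have e: "\<bar>e ^ Suc a\<bar> \<le> 1" using Cons.prems unfolding power_abs by (intro power_le_one) auto
    have "real (Suc a) ^ 2 \<le> real (Suc a) ^ s" using Cons.prems by (intro power_increasing) auto
    then have "1 / real (Suc a) ^ s \<le> 1 / real (Suc a) ^ 2" by (intro divide_left_mono) auto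
    moreover have "\<bar>e ^ Suc a / real (Suc a) ^ s\<bar> \<le> 1 / real (Suc a) ^ s"
      using e by (simp only: abs_divide) (simp add: divide_right_mono)
    ultimately have "\<bar>e ^ Suc a / real (Suc a) ^ s\<bar> \<le> 1 / real (Suc a) ^ 2" by linarith
    then show "norm (t a) \<le> 1 / real (Suc a) ^ 2 * B"
      unfolding t_def real_norm_def abs_mult by (intro mult_mono B) auto
  qed
  moreover have "euler_partial (s # ss) (e # es) = (\<lambda>N. \<Sum>a<N. t a)"
  proof
    fix N show "euler_partial (s # ss) (e # es) N = (\<Sum>a<N. t a)"
      unfolding euler_partial_Cons t_def by (induction N) simp_all
  qed
  ultimately show ?case by (simp add: summable_iff_convergent)
qed

definition exponents :: "nat \<Rightarrow> nat \<Rightarrow> nat list set" where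
  "exponents n d = {js. length js = d \<and> (\<forall>j\<in>set js. 1 \<le> j) \<and> sum_list js = n}"

definition signs :: "nat \<Rightarrow> nat \<Rightarrow> real list set" where
  "signs \<alpha> d = {es. length es = d \<and> set es \<subseteq> {1, -1} \<and> count_list es (-1) = \<alpha>}"

lemma A_index_eq: "A_index \<alpha> (2 * n) d = exponents n d \<times> signs \<alpha> d"
  by (auto simp: A_index_def exponents_def signs_def)

lemma finite_exponents: "finite (exponents n d)"
proof (rule finite_subset)
  show "exponents n d \<subseteq> {js. set js \<subseteq> {..n} \<and> length js = d}"
    using member_le_sum_list by (fastforce simp: exponents_def)
qed (simp add: finite_lists_length_eq)

lemma finite_signs: "finite (signs \<alpha> d)"
  by (rule finite_subset[OF _ finite_lists_length_eq[of "{1, -1 :: real}" d]]) (auto simp: signs_def)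

lemma A_tendsto:
  "(\<lambda>N. \<Sum>js\<in>exponents n d. \<Sum>es\<in>signs \<alpha> d. euler_partial (map (\<lambda>j. 2 * j) js) es N)
     \<longlonglongrightarrow> A \<alpha> (2 * n) d"
proof -
  have "euler_partial (map (\<lambda>j. 2 * j) js) es \<longlonglongrightarrow> euler_sum (map (\<lambda>j. 2 * j) js) es"
    if "js \<in> exponents n d" "es \<in> signs \<alpha> d" for js es
  proof -
    have "convergent (euler_partial (map (\<lambda>j. 2 * j) js) es)"
      using that by (intro convergent_euler_partial) (auto simp: exponents_def signs_def)
    then show ?thesis
      unfolding convergent_LIMSEQ_iff euler_sum_def euler_partial_def[symmetric] .
  qed
  then show ?thesis
    unfolding A_def A_index_eq sum.cartesian_product[symmetric] by (intro tendsto_sum)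
qed

text \<open>
In the coefficient of a product, exponent vectors with an entry 0 contribute nothing because \<open>geo\<close> has no constant term.
\<close>

lemma geo_product_nth:
  "(\<Prod>i<d. geo (ns ! i)) $ n = (\<Sum>js\<in>exponents n d. \<Prod>i<d. 1 / real (ns ! i) ^ (2 * (js ! i)))"
proof (cases d)
  case 0
  have "exponents n 0 = (if n = 0 then {[]} else {})" by (auto simp: exponents_def)
  then show ?thesis using 0 by simp
next
  case (Suc m)
  have sub: "exponents n d \<subseteq> natpermute n d" by (auto simp: exponents_def natpermute_def)
  have d: "{..<d} = {0..m}" using Suc by auto
  have "(\<Prod>i<d. geo (ns ! i)) $ n = (\<Sum>js\<in>natpermute n d. \<Prod>i<d. geo (ns ! i) $ (js ! i))"
    unfolding d fps_prod_nth by (simp only: Suc Suc_eq_plus1)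
  also have "\<dots> = (\<Sum>js\<in>exponents n d. \<Prod>i<d. geo (ns ! i) $ (js ! i))"
  proof (rule sum.mono_neutral_right[OF _ sub], safe)
    show "finite (natpermute n d)" by (simp add: natpermute_finite)
    fix js assume "js \<in> natpermute n d" "js \<notin> exponents n d"
    then obtain i where "i < d" "js ! i = 0"
      by (auto simp: natpermute_def exponents_def in_set_conv_nth)
    then show "(\<Prod>i<d. geo (ns ! i) $ (js ! i)) = 0"
      by (intro prod_zero bexI[of _ i]) (simp_all add: geo_nth)
  qed
  also have "\<dots> = (\<Sum>js\<in>exponents n d. \<Prod>i<d. 1 / real (ns ! i) ^ (2 * (js ! i)))"
  proof (intro sum.cong prod.cong refl)
    fix js i assume "js \<in> exponents n d" "i \<in> {..<d}"
    then have "js ! i \<noteq> 0" by (auto simp: exponents_def all_set_conv_all_nth)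
    then show "geo (ns ! i) $ (js ! i) = 1 / real (ns ! i) ^ (2 * (js ! i))" by (simp add: geo_nth)
  qed
  finally show ?thesis .
qed

text \<open>
For a fixed tuple the summations over signs and over exponents are independent, so the sum factors.
\<close>

lemma A_partial_eq:
  "(\<Sum>js\<in>exponents n d. \<Sum>es\<in>signs \<alpha> d. euler_partial (map (\<lambda>j. 2 * j) js) es N) =
   (\<Sum>ns\<in>decr_tuples d N. fps_const (\<Sum>es\<in>signs \<alpha> d. \<Prod>i<d. (es ! i) ^ (ns ! i)) * (\<Prod>i<d. geo (ns ! i))) $ n"
proof -
  have "(\<Sum>js\<in>exponents n d. \<Sum>es\<in>signs \<alpha> d. euler_partial (map (\<lambda>j. 2 * j) js) es N) =
    (\<Sum>js\<in>exponents n d. \<Sum>es\<in>signs \<alpha> d. \<Sum>ns\<in>decr_tuples d N.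
       (\<Prod>i<d. (es ! i) ^ (ns ! i)) * (\<Prod>i<d. 1 / real (ns ! i) ^ (2 * (js ! i))))"
    by (intro sum.cong refl) (auto simp: euler_partial_def exponents_def prod_dividef intro!: sum.cong)
  also have "\<dots> = (\<Sum>js\<in>exponents n d. \<Sum>ns\<in>decr_tuples d N.
       (\<Sum>es\<in>signs \<alpha> d. \<Prod>i<d. (es ! i) ^ (ns ! i)) * (\<Prod>i<d. 1 / real (ns ! i) ^ (2 * (js ! i))))"
    by (subst sum.swap) (simp only: sum_distrib_right)
  also have "\<dots> = (\<Sum>ns\<in>decr_tuples d N.
       (\<Sum>es\<in>signs \<alpha> d. \<Prod>i<d. (es ! i) ^ (ns ! i)) * (\<Sum>js\<in>exponents n d. \<Prod>i<d. 1 / real (ns ! i) ^ (2 * (js ! i))))"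
    by (subst sum.swap) (simp only: sum_distrib_left)
  finally show ?thesis
    by (simp add: fps_sum_nth geo_product_nth)
qed

section \<open>Depth three\<close>

lemma signs_3:
  "signs 1 3 = {[-1, 1, 1], [1, -1, 1], [1, 1, -1]}"
  "signs 2 3 = {[-1, -1, 1], [-1, 1, -1], [1, -1, -1]}"
  by (auto simp: signs_def numeral_3_eq_3 length_Suc_conv split: if_splits)

lemma sum_decr_tuples_3:
  "sum f (decr_tuples 3 N) = (\<Sum>a=1..N. \<Sum>b=1..a-1. \<Sum>c=1..b-1. f [a, b, c])"
  by (simp add: numeral_3_eq_3 sum_decr_tuples_Suc decr_tuples_0)

lemma sum_by_parity: "(\<Sum>m=1..2*N. f m) = (\<Sum>i<N. f (2 * i + 2)) + (\<Sum>i<N. f (2 * i + 1))"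
  for f :: "nat \<Rightarrow> 'a :: comm_monoid_add"
  by (induction N) (simp_all add: ac_simps)

definition signed_geo :: "nat \<Rightarrow> real fps" where
  "signed_geo m = fps_const ((-1) ^ m) * geo m"

lemma signed_geo_parity: "signed_geo (2 * i + 2) = geo (2 * i + 2)" "signed_geo (2 * i + 1) = - geo (2 * i + 1)"
  by (simp_all add: signed_geo_def flip: fps_const_neg)

text \<open>
Summing up to an even bound \<open>2N\<close> makes the sums over even and over odd numbers equally long. Since the full sequence
of partial sums converges, this subsequence determines the limit.
\<close>

lemma A_3_tendsto:
  defines "p \<equiv> ap_sum 2" and "q \<equiv> ap_sum 1"
  shows "(\<lambda>N. ((p 1 N - q 1 N) * (p 1 N + q 1 N) ^ 2 - 2 * (p 2 N - q 2 N) * (p 1 N + q 1 N)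
           - (p 2 N + q 2 N) * (p 1 N - q 1 N) + (2 * p 3 N - 2 * q 3 N)) $ n) \<longlonglongrightarrow> 2 * A 1 (2 * n) 3"
    and "(\<lambda>N. ((p 1 N + q 1 N) * (p 1 N - q 1 N) ^ 2 - 2 * (p 2 N - q 2 N) * (p 1 N - q 1 N)
           - (p 2 N + q 2 N) * (p 1 N + q 1 N) + (2 * p 3 N + 2 * q 3 N)) $ n) \<longlonglongrightarrow> 2 * A 2 (2 * n) 3"
proof -
  define S where "S \<alpha> N = (\<Sum>ns\<in>decr_tuples 3 N.
      fps_const (\<Sum>es\<in>signs \<alpha> 3. \<Prod>i<3. (es ! i) ^ (ns ! i)) * (\<Prod>i<3. geo (ns ! i)))" for \<alpha> N
  have lim: "(\<lambda>N. (2 * S \<alpha> (2 * N)) $ n) \<longlonglongrightarrow> 2 * A \<alpha> (2 * n) 3" for \<alpha>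
  proof -
    have "(\<lambda>N. S \<alpha> N $ n) \<longlonglongrightarrow> A \<alpha> (2 * n) 3"
      using A_tendsto[of \<alpha> 3 n] unfolding A_partial_eq S_def .
    then have "(\<lambda>N. S \<alpha> (2 * N) $ n) \<longlonglongrightarrow> A \<alpha> (2 * n) 3"
      by (rule filterlim_compose) (simp add: filterlim_at_top_mult_tendsto_pos filterlim_subseq strict_mono_def)
    then show ?thesis by (simp add: tendsto_mult_left fps_numeral_fps_const)
  qed
  let ?x = geo and ?y = signed_geo
  have sums: "(\<Sum>m=1..2*N. ?x m) = p 1 N + q 1 N" "(\<Sum>m=1..2*N. ?y m) = p 1 N - q 1 N"
    "(\<Sum>m=1..2*N. ?x m * ?x m) = p 2 N + q 2 N" "(\<Sum>m=1..2*N. ?y m * ?y m) = p 2 N + q 2 N"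
    "(\<Sum>m=1..2*N. ?x m * ?y m) = p 2 N - q 2 N" "(\<Sum>m=1..2*N. ?y m * ?x m) = p 2 N - q 2 N"
    "(\<Sum>m=1..2*N. ?x m * ?x m * ?y m) = p 3 N - q 3 N"
    "(\<Sum>m=1..2*N. ?y m * ?y m * ?x m) = p 3 N + q 3 N" for N
    unfolding sum_by_parity signed_geo_parity p_def q_def ap_sum_def
    by (simp_all add: sum_negf power2_eq_square power3_eq_cube)
  \<comment> \<open>With the two unsigned sequences equal, each of the three sign patterns occurs twice.\<close>
  have S1: "2 * S 1 M = (\<Sum>a=1..M. \<Sum>b=1..a-1. \<Sum>c=1..b-1.
      ?x a * (?x b * ?y c + ?y b * ?x c) + ?x a * (?x b * ?y c + ?y b * ?x c) + ?y a * (?x b * ?x c + ?x b * ?x c))" for M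
    unfolding S_def sum_decr_tuples_3 sum_distrib_left signs_3
    by (intro sum.cong refl) (simp add: signed_geo_def numeral_3_eq_3 algebra_simps flip: fps_const_add)
  have "2 * S 1 (2 * N) = (p 1 N - q 1 N) * (p 1 N + q 1 N) ^ 2 - 2 * (p 2 N - q 2 N) * (p 1 N + q 1 N)
           - (p 2 N + q 2 N) * (p 1 N - q 1 N) + (2 * p 3 N - 2 * q 3 N)" for N
    unfolding S1 sum_triangle_triple sums by (simp add: algebra_simps power2_eq_square)
  with lim[of 1] show "(\<lambda>N. ((p 1 N - q 1 N) * (p 1 N + q 1 N) ^ 2 - 2 * (p 2 N - q 2 N) * (p 1 N + q 1 N)
           - (p 2 N + q 2 N) * (p 1 N - q 1 N) + (2 * p 3 N - 2 * q 3 N)) $ n) \<longlonglongrightarrow> 2 * A 1 (2 * n) 3"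
    by (simp only:)
  have S2: "2 * S 2 M = (\<Sum>a=1..M. \<Sum>b=1..a-1. \<Sum>c=1..b-1.
      ?y a * (?y b * ?x c + ?x b * ?y c) + ?y a * (?y b * ?x c + ?x b * ?y c) + ?x a * (?y b * ?y c + ?y b * ?y c))" for M
    unfolding S_def sum_decr_tuples_3 sum_distrib_left signs_3
    by (intro sum.cong refl) (simp add: signed_geo_def numeral_3_eq_3 algebra_simps flip: fps_const_add fps_const_mult)
  have "2 * S 2 (2 * N) = (p 1 N + q 1 N) * (p 1 N - q 1 N) ^ 2 - 2 * (p 2 N - q 2 N) * (p 1 N - q 1 N)
           - (p 2 N + q 2 N) * (p 1 N + q 1 N) + (2 * p 3 N + 2 * q 3 N)" for N
    unfolding S2 sum_triangle_triple sums by (simp add: algebra_simps power2_eq_square)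
  with lim[of 2] show "(\<lambda>N. ((p 1 N + q 1 N) * (p 1 N - q 1 N) ^ 2 - 2 * (p 2 N - q 2 N) * (p 1 N - q 1 N)
           - (p 2 N + q 2 N) * (p 1 N + q 1 N) + (2 * p 3 N + 2 * q 3 N)) $ n) \<longlonglongrightarrow> 2 * A 2 (2 * n) 3"
    by (simp only:)
qed

theorem proposition6p2:
  fixes n :: nat
  assumes "n \<ge> 3"
  shows "A 1 (2 * n) 3 = 7 / 8 * zeta (2 * n) + zeta_bar (2 * n) \<and>
         A 2 (2 * n) 3 = 7 / 8 * zeta (2 * n) + zeta_bar (2 * n)"
proof -
  define T where "T = fps_const (even_series $ 1) * fps_X"
  define p2 q2 where "p2 = fps_XD even_series - even_series" and "q2 = fps_XD odd_series - odd_series"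
  define p3 q3 where "p3 = fps_XD p2 - 2 * p2" and "q3 = fps_XD q2 - 2 * q2"
  have rels: "2 * even_series ^ 2 = 2 * p2 + 3 * (even_series - T)" "2 * odd_series ^ 2 = 2 * q2 + (odd_series - 3 * T)"
    "2 * (even_series * odd_series) = odd_series - 3 * T" "fps_XD even_series = even_series + p2" "fps_XD odd_series = odd_series + q2"
    "4 * even_series * fps_XD even_series = 2 * (2 * p2 + p3) + 3 * (fps_XD even_series - T)"
    "4 * odd_series * fps_XD odd_series = 2 * (2 * q2 + q3) + (fps_XD odd_series - 3 * T)"
    using ap_series_relations by (simp_all add: p2_def q2_def p3_def q3_def T_def)
  have lims: "fps_tendsto (ap_sum 1 1) odd_series" "fps_tendsto (ap_sum 2 1) even_series"
    "fps_tendsto (ap_sum 1 2) q2" "fps_tendsto (ap_sum 2 2) p2"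
    "fps_tendsto (\<lambda>N. 2 * ap_sum 1 3 N) q3" "fps_tendsto (\<lambda>N. 2 * ap_sum 2 3 N) p3"
    unfolding p2_def q2_def p3_def q3_def
    by (intro ap_sum_1_tendsto ap_sum_2_tendsto ap_sum_3_tendsto zero_less_one pos2)+
  \<comment> \<open>The linear term \<open>T\<close> disappears here, because \<open>n > 1\<close>.\<close>
  have limit_value: "a = 7 / 8 * zeta (2 * n) + zeta_bar (2 * n)"
    if F: "(\<lambda>N. F N $ n) \<longlonglongrightarrow> 2 * a" and G: "fps_tendsto F G" and eq: "8 * G = 2 * (15 * even_series - odd_series - 12 * T)"
    for a F G
  proof -
    have "G $ n = 2 * a" using F G LIMSEQ_unique unfolding fps_tendsto_def by blast
    moreover have "8 * G $ n = 2 * (15 * even_series $ n - odd_series $ n)"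
      using arg_cong[OF eq, of "\<lambda>f. f $ n"] assms by (simp add: T_def numeral_fps_const)
    ultimately show ?thesis
      using zeta_conv_ap_series(1,2)[of n] assms by (simp add: field_simps)
  qed
  show ?thesis
  proof
    show "A 1 (2 * n) 3 = 7 / 8 * zeta (2 * n) + zeta_bar (2 * n)"
      by (rule limit_value[OF A_3_tendsto(1) _ power_sum_relations(1)[OF rels]]) (intro lims fps_tendsto_intros)
    show "A 2 (2 * n) 3 = 7 / 8 * zeta (2 * n) + zeta_bar (2 * n)"
      by (rule limit_value[OF A_3_tendsto(2) _ power_sum_relations(2)[OF rels]]) (intro lims fps_tendsto_intros)
  qed
qed

end
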